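(* Let $\Omega\subset\mathbb{R}^3$ be a bounded simply-connected (in particular connected) open set with smooth boundary and let $Q:\Omega\to S_0$ be a real analytic function. Then the set of points of $\Omega$ where $Q$ is uniaxial or isotropic is either the whole of $\Omega$ or has zero Lebesgue measure.
   Context: $S_0$ is the space of real symmetric traceless $3\times3$ matrices. A matrix $Q\in S_0$ is isotropic if $Q=0$; uniaxial if it has two equal non-zero eigenvalues, equivalently $Q=s(n\otimes n-\frac13 Id)$ for some $s\in\mathbb{R}\setminus\{0\}$ and unit vector $n\in\mathbb{R}^3$; and biaxial if its three eigenvalues are distinct. *)

theory Defs
  imports "HOL-Analysis.Analysis" "HOL-Computational_Algebra.Polynomial"
begin

definition S0 :: "(real^3^3) set" where
  "S0 = {A. transpose A = A \<and> trace A = 0}"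

(* det (X * Id - A), computed over the polynomial ring *)
definition charpoly :: "'a::comm_ring_1^'n^'n \<Rightarrow> 'a poly" where
  "charpoly A = det (\<chi> i j. (if i = j then [:0, 1:] else 0) - [:A $ i $ j:])"

lemma poly_charpoly: "poly (charpoly A) x = det (mat x - A)"
proof -
  have "poly (of_int k :: 'a poly) x = of_int k" for k
    by (simp add: of_int_poly)
  moreover have "poly ((if i = j then [:0, 1:] else 0) - [:A $ i $ j:]) x = (mat x - A) $ i $ j" for i j
    by (simp add: mat_def)
  ultimately show ?thesis
    by (simp add: charpoly_def det_def poly_sum poly_prod)
qed

definition isotropic :: "real^3^3 \<Rightarrow> bool" where
  "isotropic A \<longleftrightarrow> A = 0"

(* Eigenvalues are counted with algebraic multiplicity. For A in S0 the trace condition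
   excludes a non-zero eigenvalue of multiplicity three. *)
definition uniaxial :: "real^3^3 \<Rightarrow> bool" where
  "uniaxial A \<longleftrightarrow> (\<exists>l. l \<noteq> 0 \<and> order l (charpoly A) \<ge> 2)"

(* Local expansion into a power series in several variables; a multi-index is a function
   k :: 'n => nat, and has_sum is unordered (hence absolute, in finite dimension) convergence. *)
definition real_analytic_on :: "(real^'n \<Rightarrow> 'b::real_normed_vector) \<Rightarrow> (real^'n) set \<Rightarrow> bool" where
  "real_analytic_on f S \<longleftrightarrow>
     (\<forall>a\<in>S. \<exists>r>0. \<exists>c :: ('n \<Rightarrow> nat) \<Rightarrow> 'b. \<forall>x\<in>ball a r.
        ((\<lambda>k. (\<Prod>i\<in>UNIV. (x $ i - a $ i) ^ k i) *\<^sub>R c k) has_sum f x) UNIV)"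

(* Intended for open U: f is of class C^m on U, by recursion on iterated partial derivatives. *)
fun C_k_on :: "nat \<Rightarrow> (real^'n \<Rightarrow> real) \<Rightarrow> (real^'n) set \<Rightarrow> bool" where
  "C_k_on 0 f U \<longleftrightarrow> continuous_on U f"
| "C_k_on (Suc m) f U \<longleftrightarrow> (\<forall>x\<in>U. f differentiable at x) \<and>
     (\<forall>i. C_k_on m (\<lambda>x. frechet_derivative f (at x) (axis i 1)) U)"

definition smooth_on :: "(real^'n \<Rightarrow> real) \<Rightarrow> (real^'n) set \<Rightarrow> bool" where
  "smooth_on f U \<longleftrightarrow> (\<forall>m. C_k_on m f U)"

(* Near each boundary point S is the negativity set of a smooth function without critical
   points. By the implicit function theorem this says that the boundary is locally a smooth
   hypersurface (graph) with S lying on exactly one side of it. *)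
definition smooth_boundary :: "(real^'n) set \<Rightarrow> bool" where
  "smooth_boundary S \<longleftrightarrow>
     (\<forall>p\<in>frontier S. \<exists>U \<rho>. open U \<and> p \<in> U \<and> smooth_on \<rho> U \<and>
        (\<forall>x\<in>U. frechet_derivative \<rho> (at x) \<noteq> (\<lambda>v. 0)) \<and>
        S \<inter> U = {x \<in> U. \<rho> x < 0})"

end

theory Submission
  imports Defs
begin

text \<open>
  For a symmetric traceless matrix \<open>A\<close> the characteristic polynomial is a depressed cubic
  \<open>X ^ 3 + p X + q\<close> whose coefficients are polynomials in the entries of \<open>A\<close>. Its discriminant
  \<open>- (4 p ^ 3 + 27 q ^ 2)\<close> vanishes exactly when \<open>A\<close> has a repeated eigenvalue, that is, when \<open>A\<close>
  is uniaxial or isotropic (\<open>uniaxial_or_isotropic_iff_discr_eq_0\<close>). Along \<open>Q\<close> the discriminant is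
  a real analytic function on a connected open set, so it suffices that the zero set of such a
  function \<open>f\<close> is everything or null (\<open>analytic_zero_set_all_or_null\<close>).

  That fact is reduced to one variable by looking at lines. The power series of \<open>f\<close>, regrouped by
  total degree, shows that \<open>f\<close> is given by a one-variable power series near each point of each line.
  On an interval such a function is either identically zero or has isolated, hence countably many,
  zeros (\<open>analytic_zeros_on_line\<close>). This has two consequences in a convex open set \<open>B\<close>:

  \<^item> If \<open>f\<close> vanishes near one point of \<open>B\<close>, then it vanishes along every segment from that point,
    hence on \<open>B\<close>. By connectedness, either \<open>f\<close> vanishes on the whole domain or it does not vanish
    identically on any nonempty convex open subset.

  \<^item> If \<open>f a \<noteq> 0\<close> for some \<open>a \<in> B\<close>, then each line through \<open>a\<close> meets the zero set in \<open>B\<close> in countably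
    many points. By Fubini applied to the dilations about \<open>a\<close>, such a set is null
    (\<open>null_set_if_countable_on_lines_through\<close>).

  Countably many convex open sets cover the domain, which gives the dichotomy.
\<close>

section \<open>Analyticity along lines\<close>

text \<open>
  A weakening of real analyticity in several variables: that it is preserved by products follows
  from the Cauchy product in one variable, with no rearrangement of multiple series, and together
  with continuity it is strong enough for the zero-set argument.
\<close>
definition analytic_on_lines :: "('a::real_normed_vector \<Rightarrow> real) \<Rightarrow> 'a set \<Rightarrow> bool" where
  "analytic_on_lines f S \<longleftrightarrow>
     (\<forall>a\<in>S. \<forall>v. \<exists>F. (\<lambda>t. f (a + t *\<^sub>R v)) has_fps_expansion F)"

lemma analytic_on_lines_const: "analytic_on_lines (\<lambda>x. c) S"
  unfolding analytic_on_lines_def by (fast intro: fps_expansion_intros)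

lemma analytic_on_lines_add:
  "analytic_on_lines f S \<Longrightarrow> analytic_on_lines g S \<Longrightarrow> analytic_on_lines (\<lambda>x. f x + g x) S"
  unfolding analytic_on_lines_def by (fast intro: fps_expansion_intros)

lemma analytic_on_lines_diff:
  "analytic_on_lines f S \<Longrightarrow> analytic_on_lines g S \<Longrightarrow> analytic_on_lines (\<lambda>x. f x - g x) S"
  unfolding analytic_on_lines_def by (fast intro: fps_expansion_intros)

lemma analytic_on_lines_mult:
  "analytic_on_lines f S \<Longrightarrow> analytic_on_lines g S \<Longrightarrow> analytic_on_lines (\<lambda>x. f x * g x) S"
  unfolding analytic_on_lines_def by (fast intro: has_fps_expansion_mult)

lemma analytic_on_lines_power:
  "analytic_on_lines f S \<Longrightarrow> analytic_on_lines (\<lambda>x. f x ^ n) S"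
  by (induction n) (simp_all add: analytic_on_lines_const analytic_on_lines_mult)

lemmas analytic_on_lines_intros =
  analytic_on_lines_const analytic_on_lines_add analytic_on_lines_diff
  analytic_on_lines_mult analytic_on_lines_power

lemma real_analytic_on_bounded_linear:
  assumes "real_analytic_on f S" and h: "bounded_linear h"
  shows "real_analytic_on (\<lambda>x. h (f x)) S"
  unfolding real_analytic_on_def
proof
  fix a assume "a \<in> S"
  then obtain r c where "r > 0" and
    c: "\<forall>x\<in>ball a r. ((\<lambda>k. (\<Prod>i\<in>UNIV. (x $ i - a $ i) ^ k i) *\<^sub>R c k) has_sum f x) UNIV"
    using assms(1) unfolding real_analytic_on_def by blast
  have "((\<lambda>k. (\<Prod>i\<in>UNIV. (x $ i - a $ i) ^ k i) *\<^sub>R h (c k)) has_sum h (f x)) UNIV"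
    if "x \<in> ball a r" for x
    using has_sum_bounded_linear[OF h c[rule_format, OF that]]
    by (simp add: o_def linear_scale[OF bounded_linear.linear[OF h]])
  with \<open>r > 0\<close> show "\<exists>r>0. \<exists>c. \<forall>x\<in>ball a r.
      ((\<lambda>k. (\<Prod>i\<in>UNIV. (x $ i - a $ i) ^ k i) *\<^sub>R c k) has_sum h (f x)) UNIV"
    by (intro exI[of _ r] conjI exI[of _ "\<lambda>k. h (c k)"]) auto
qed

lemma finite_multi_indices: "finite {k :: 'n::finite \<Rightarrow> nat. sum k UNIV = m}"
proof (rule finite_subset)
  have "k i \<le> sum k UNIV" for k :: "'n \<Rightarrow> nat" and i
    by (rule member_le_sum) auto
  then show "{k :: 'n \<Rightarrow> nat. sum k UNIV = m} \<subseteq> (\<Pi>\<^sub>E i\<in>UNIV. {..m})"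
    by (auto simp: PiE_UNIV_domain)
qed (simp add: finite_PiE)

text \<open>
  Substituting \<open>x = a + t v\<close> turns the monomial with multi-index \<open>k\<close> into a multiple of
  \<open>t ^ (\<Sum>i. k i)\<close>. Only finitely many multi-indices have a given total degree, so unordered
  convergence permits summing them first, which leaves a power series in \<open>t\<close>.
\<close>
lemma real_analytic_on_imp_analytic_on_lines:
  fixes f :: "real^'n \<Rightarrow> real"
  assumes "real_analytic_on f S"
  shows "analytic_on_lines f S"
  unfolding analytic_on_lines_def
proof (intro ballI allI)
  fix a v assume "a \<in> S"
  then obtain r c where "r > 0" and
    c: "\<And>x. x \<in> ball a r \<Longrightarrow>
          ((\<lambda>k. (\<Prod>i\<in>UNIV. (x $ i - a $ i) ^ k i) *\<^sub>R c k) has_sum f x) UNIV"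
    using assms unfolding real_analytic_on_def by blast
  define B where "B m = {k :: 'n \<Rightarrow> nat. sum k UNIV = m}" for m
  define d where "d m = (\<Sum>k\<in>B m. (\<Prod>i\<in>UNIV. v $ i ^ k i) * c k)" for m
  have d: "(\<lambda>m. d m * t ^ m) sums f (a + t *\<^sub>R v)" if "a + t *\<^sub>R v \<in> ball a r" for t
  proof -
    define g where "g k = t ^ sum k UNIV * ((\<Prod>i\<in>UNIV. v $ i ^ k i) * c k)" for k
    have "(g has_sum f (a + t *\<^sub>R v)) UNIV"
      using c[OF that] by (simp add: g_def[abs_def] power_mult_distrib prod.distrib power_sum mult_ac)
    moreover have "UNIV = snd ` Sigma UNIV B"
      by (force simp: B_def image_iff)
    moreover have "inj_on snd (Sigma UNIV B)"
      by (auto simp: B_def inj_on_def)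
    ultimately have "((g \<circ> snd) has_sum f (a + t *\<^sub>R v)) (Sigma UNIV B)"
      by (metis has_sum_reindex)
    moreover have "((\<lambda>k. (g \<circ> snd) (m, k)) has_sum d m * t ^ m) (B m)" for m
    proof -
      have "((\<lambda>k. (g \<circ> snd) (m, k)) has_sum (\<Sum>k\<in>B m. g k)) (B m)"
        using has_sum_finite[of "B m" g] by (simp add: B_def finite_multi_indices)
      also have "(\<Sum>k\<in>B m. g k) = d m * t ^ m"
        by (simp add: g_def d_def B_def sum_distrib_left mult.commute)
      finally show ?thesis .
    qed
    ultimately have "((\<lambda>m. d m * t ^ m) has_sum f (a + t *\<^sub>R v)) UNIV"
      by (rule has_sum_Sigma')
    then show ?thesis
      by (rule has_sum_imp_sums)
  qed
  have "open ((\<lambda>t. a + t *\<^sub>R v) -` ball a r)"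
    by (intro continuous_open_vimage open_ball continuous_intros)
  then have "\<forall>\<^sub>F t in nhds 0. t \<in> (\<lambda>t. a + t *\<^sub>R v) -` ball a r"
    using \<open>r > 0\<close> by (intro eventually_nhds_in_open) auto
  then have "(\<lambda>t. f (a + t *\<^sub>R v)) has_fps_expansion Abs_fps d"
    by (intro has_fps_expansionI) (auto elim!: eventually_mono intro: d)
  then show "\<exists>F. (\<lambda>t. f (a + t *\<^sub>R v)) has_fps_expansion F" ..
qed

text \<open>
  The terms of the series are continuous, and on a small ball they are dominated by their values at
  \<open>a + e (1, \<dots>, 1)\<close>, where the series converges absolutely; the M-test applies.
\<close>
lemma real_analytic_on_imp_isCont:
  fixes f :: "real^'n \<Rightarrow> real"
  assumes "real_analytic_on f S" "a \<in> S"
  shows "isCont f a"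
proof -
  obtain r c where "r > 0" and
    c: "\<And>x. x \<in> ball a r \<Longrightarrow>
          ((\<lambda>k. (\<Prod>i\<in>UNIV. (x $ i - a $ i) ^ k i) *\<^sub>R c k) has_sum f x) UNIV"
    using assms unfolding real_analytic_on_def by blast
  \<comment> \<open>\<open>norm 1\<close> is the length of \<open>(1, \<dots>, 1)\<close>; with this \<open>e\<close> the corner \<open>a + e *\<^sub>R 1\<close> of the cube
     of half-width \<open>e\<close> around \<open>a\<close> still lies in the ball of convergence.\<close>
  define e where "e = r / (norm (1 :: real^'n) + 1)"
  have "e > 0" using \<open>r > 0\<close> by (simp add: e_def add_nonneg_pos)
  have "e * norm (1 :: real^'n) < r"
    using \<open>r > 0\<close> by (simp add: e_def field_simps add_nonneg_pos)
  then have "a + e *\<^sub>R 1 \<in> ball a r"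
    using \<open>e > 0\<close> by (simp add: dist_norm)
  from c[OF this] have "(\<lambda>k. (\<Prod>i\<in>UNIV. e ^ k i) *\<^sub>R c k) summable_on UNIV"
    by (auto simp: summable_on_def)
  then have M: "(\<lambda>k. norm ((\<Prod>i\<in>UNIV. e ^ k i) *\<^sub>R c k)) summable_on UNIV"
    by (rule summable_on_iff_abs_summable_on_real[THEN iffD1])
  define Y where "Y = ball a (min e r)"
  have le: "norm ((\<Prod>i\<in>UNIV. (x $ i - a $ i) ^ k i) *\<^sub>R c k) \<le> norm ((\<Prod>i\<in>UNIV. e ^ k i) *\<^sub>R c k)"
    if "x \<in> Y" for x k
  proof -
    have "\<bar>x $ i - a $ i\<bar> \<le> e" for i
      using component_le_norm_cart[of "x - a" i] that
      by (simp add: Y_def dist_norm norm_minus_commute)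
    then have "(\<Prod>i\<in>UNIV. \<bar>x $ i - a $ i\<bar> ^ k i) \<le> (\<Prod>i\<in>UNIV. e ^ k i)"
      by (intro prod_mono) (auto intro: power_mono)
    then show ?thesis
      using \<open>e > 0\<close> by (auto simp: abs_mult abs_prod power_abs intro!: mult_right_mono)
  qed
  have "uniform_limit Y (\<lambda>K x. \<Sum>k\<in>K. (\<Prod>i\<in>UNIV. (x $ i - a $ i) ^ k i) *\<^sub>R c k) f
          (finite_subsets_at_top UNIV)"
    by (rule Weierstrass_m_test_general'[OF le _ M]) (use c in \<open>auto simp: Y_def\<close>)
  then have "continuous_on Y f"
    by (rule uniform_limit_theorem[rotated]) (auto intro!: always_eventually continuous_intros)
  then show ?thesis
    using \<open>e > 0\<close> \<open>r > 0\<close> by (simp add: Y_def continuous_on_eq_continuous_at)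
qed

section \<open>Zeros in one variable\<close>

text \<open>
  Dividing by the lowest power of \<open>t\<close> that occurs leaves a continuous function with nonzero value
  at \<open>0\<close>.
\<close>
lemma has_fps_expansion_eventually_nonzero:
  fixes f :: "'a::{banach, real_normed_field} \<Rightarrow> 'a"
  assumes F: "f has_fps_expansion F" and "F \<noteq> 0"
  shows "\<forall>\<^sub>F t in at 0. f t \<noteq> 0"
proof -
  let ?n = "subdegree F"
  let ?g = "\<lambda>t. if t = 0 then fps_nth F ?n else f t / t ^ ?n"
  have "?g has_fps_expansion fps_shift ?n F"
    using F by (rule has_fps_expansion_shift) auto
  then have "isCont ?g 0"
    by (rule has_fps_expansion_imp_continuous)
  then have "(?g \<longlongrightarrow> fps_nth F ?n) (at 0)"
    by (simp add: isCont_def)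
  then have "\<forall>\<^sub>F t in at 0. ?g t \<noteq> 0"
    by (rule tendsto_imp_eventually_ne) (use \<open>F \<noteq> 0\<close> in auto)
  moreover have "\<forall>\<^sub>F t in at 0. (t :: 'a) \<noteq> 0"
    by (simp add: eventually_at_filter)
  ultimately show ?thesis
    by eventually_elim auto
qed

text \<open>
  Each point of \<open>I\<close> either has a neighbourhood on which \<open>g\<close> vanishes or a punctured neighbourhood
  without zeros. Both alternatives are open conditions, so the same one holds throughout the
  connected set \<open>I\<close>.
\<close>
lemma analytic_zeros_on_line:
  fixes g :: "real \<Rightarrow> real"
  assumes "open I" "connected I"
    and an: "analytic_on_lines g I"
  shows "(\<forall>t\<in>I. g t = 0) \<or> {t\<in>I. g t = 0} sparse_in I"
proof -
  let ?flat = "\<lambda>t. \<forall>\<^sub>F s in nhds t. g s = 0"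
  have dichotomy: "?flat t \<or> (\<forall>\<^sub>F s in at t. g s \<noteq> 0)" if "t \<in> I" for t
  proof -
    obtain F where F: "(\<lambda>h. g (t + h)) has_fps_expansion F"
      using an[unfolded analytic_on_lines_def, rule_format, OF \<open>t \<in> I\<close>, of 1] by auto
    show ?thesis
    proof (cases "F = 0")
      case True
      with F have "\<forall>\<^sub>F h in nhds 0. g (t + h) = 0"
        by (auto simp: has_fps_expansion_def elim: eventually_mono)
      moreover have "nhds t = filtermap (\<lambda>h. t + h) (nhds 0)"
        using filtermap_nhds_shift[of "- t" 0] by (simp add: add.commute)
      ultimately show ?thesis
        by (simp add: eventually_filtermap)
    next
      case False
      then have "\<forall>\<^sub>F h in at 0. g (t + h) \<noteq> 0"
        using F by (rule has_fps_expansion_eventually_nonzero[rotated])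
      then show ?thesis
        by (simp add: at_to_0[of t] eventually_filtermap add.commute)
    qed
  qed
  have local_const: "\<forall>\<^sub>F s in at t within I. ?flat t = ?flat s" if "t \<in> I" for t
  proof (cases "?flat t")
    case True
    then have "\<forall>\<^sub>F s in nhds t. ?flat s"
      by (simp add: eventually_eventually)
    then have "\<forall>\<^sub>F s in at t within I. ?flat s"
      by (simp add: eventually_at_filter eventually_mono)
    with True show ?thesis by (auto elim: eventually_mono)
  next
    case False
    with dichotomy[OF that] have "\<forall>\<^sub>F s in at t. g s \<noteq> 0" by blast
    then have "\<forall>\<^sub>F s in at t within I. g s \<noteq> 0"
      by (rule filter_leD[OF at_le[of I UNIV], rotated]) simp
    then have "\<forall>\<^sub>F s in at t within I. \<not> ?flat s"
      by (rule eventually_mono) (auto dest: eventually_nhds_x_imp_x)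
    with False show ?thesis by (auto elim: eventually_mono)
  qed
  have const: "?flat s = ?flat t" if "s \<in> I" "t \<in> I" for s t
    by (rule connected_local_const[OF \<open>connected I\<close> that]) (use local_const in blast)
  show ?thesis
  proof (cases "\<exists>t\<in>I. ?flat t")
    case True
    with const have "\<forall>t\<in>I. ?flat t" by blast
    then show ?thesis by (auto dest: eventually_nhds_x_imp_x)
  next
    case False
    with dichotomy have "\<forall>t\<in>I. \<forall>\<^sub>F s in at t. g s \<noteq> 0" by blast
    then have "{t\<in>I. g t = 0} sparse_in I"
      unfolding sparse_in_eventually_iff[OF \<open>open I\<close>] by (auto elim: eventually_mono)
    then show ?thesis ..
  qed
qed

section \<open>Sets that are countable on lines through a point\<close>

text \<open>
  For each \<open>v\<close>, almost every \<open>t\<close> satisfies \<open>a + t v \<notin> Z\<close>. By Fubini, for almost every \<open>t\<close>, and hence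
  for some \<open>t \<noteq> 0\<close>, almost every \<open>v\<close> satisfies it. The preimage of \<open>Z\<close> under this one dilation is
  null, and therefore so is \<open>Z\<close>. Dilating instead of using polar coordinates avoids any integral
  formula.
\<close>
lemma null_set_if_countable_on_lines_through:
  fixes a :: "'a::euclidean_space"
  assumes Z: "Z \<in> sets borel" and lines: "\<And>v. countable {t. a + t *\<^sub>R v \<in> Z}"
  shows "Z \<in> null_sets lborel"
proof -
  have meas: "(\<lambda>p. a + snd p *\<^sub>R fst p) \<in> borel_measurable (lborel \<Otimes>\<^sub>M (lborel :: real measure))"
    by measurable
  have sets: "{p \<in> space (lborel \<Otimes>\<^sub>M (lborel :: real measure)). a + snd p *\<^sub>R fst p \<notin> Z}
      \<in> sets (lborel \<Otimes>\<^sub>M lborel)"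
  proof -
    have "{p \<in> space (lborel \<Otimes>\<^sub>M lborel). a + snd p *\<^sub>R fst p \<notin> Z}
        = (\<lambda>p. a + snd p *\<^sub>R fst p) -` (- Z) \<inter> space (lborel \<Otimes>\<^sub>M (lborel :: real measure))"
      by auto
    also have "\<dots> \<in> sets (lborel \<Otimes>\<^sub>M lborel)"
      using Z by (intro measurable_sets[OF meas] borel_comp)
    finally show ?thesis .
  qed
  have "AE v in lborel. AE t in lborel. a + t *\<^sub>R v \<notin> Z"
    using countable_imp_null_set_lborel[OF lines]
    by (intro always_eventually allI AE_I'[where N="{t. a + t *\<^sub>R _ \<in> Z}"]) auto
  then have "AE t in (lborel :: real measure). AE v in lborel. a + t *\<^sub>R v \<notin> Z"
    using lborel_pair.AE_commute[OF sets] by simp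
  moreover have "AE t in lborel. t \<noteq> (0 :: real)"
    by (rule AE_lborel_singleton)
  ultimately have "AE t in (lborel :: real measure). t \<noteq> 0 \<and> (AE v in lborel. a + t *\<^sub>R v \<notin> Z)"
    by eventually_elim auto
  moreover have "ae_filter (lborel :: real measure) \<noteq> bot"
    by (simp add: ae_filter_eq_bot_iff)
  ultimately obtain t :: real where "t \<noteq> 0" and t: "AE v in lborel. a + t *\<^sub>R v \<notin> Z"
    using eventually_happens' by blast
  \<comment> \<open>Up to the factor \<open>\<bar>t\<bar> ^ DIM('a)\<close>, Lebesgue measure is its own image under the map
     \<open>\<lambda>v. a + t *\<^sub>R v\<close>, so one null preimage with \<open>t \<noteq> 0\<close> is enough.\<close>
  have "AE x in lborel. x \<notin> Z"
    by (subst lborel_affine[OF \<open>t \<noteq> 0\<close>, of a]) (use t Z in \<open>simp add: AE_density AE_distr_iff\<close>)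
  then show ?thesis
    using Z by (simp add: AE_iff_null)
qed

section \<open>The zero set on a convex open set\<close>

lemma analytic_on_lines_restrict:
  assumes an: "analytic_on_lines f S"
  shows "analytic_on_lines (\<lambda>t. f (a + t *\<^sub>R v)) {t. a + t *\<^sub>R v \<in> S}"
  unfolding analytic_on_lines_def
proof (intro ballI allI)
  fix t u :: real
  assume "t \<in> {t. a + t *\<^sub>R v \<in> S}"
  then have "\<exists>F. (\<lambda>s. f ((a + t *\<^sub>R v) + s *\<^sub>R (u *\<^sub>R v))) has_fps_expansion F"
    using an unfolding analytic_on_lines_def by blast
  then show "\<exists>F. (\<lambda>s. f (a + (t + s *\<^sub>R u) *\<^sub>R v)) has_fps_expansion F"
    by (simp add: algebra_simps)
qed

text \<open>
  Convexity makes the section of \<open>B\<close> by a line an interval, so the dichotomy in one variable applies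
  to the whole section at once.
\<close>
lemma analytic_zeros_on_line_in_convex:
  fixes f :: "'a::real_normed_vector \<Rightarrow> real"
  assumes "open B" "convex B" "analytic_on_lines f B"
  defines "I \<equiv> \<lambda>a v. {t. a + t *\<^sub>R v \<in> B}"
  shows "open (I a v)"
    and "(\<forall>t\<in>I a v. f (a + t *\<^sub>R v) = 0) \<or> {t\<in>I a v. f (a + t *\<^sub>R v) = 0} sparse_in I a v"
proof -
  have I: "I a v = (\<lambda>t. a + t *\<^sub>R v) -` B"
    by (auto simp: I_def)
  show "open (I a v)"
    unfolding I by (intro continuous_open_vimage \<open>open B\<close> continuous_intros)
  moreover have "convex (I a v)"
  proof -
    have "I a v = (\<lambda>t. t *\<^sub>R v) -` ((\<lambda>x. x - a) ` B)"
      by (force simp: I_def image_iff)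
    moreover have "convex ((\<lambda>x. x - a) ` B)"
      using convex_translation_subtract_eq \<open>convex B\<close> by blast
    ultimately show ?thesis
      by (simp add: convex_linear_vimage bounded_linear.linear[OF bounded_linear_scaleR_left])
  qed
  ultimately show "(\<forall>t\<in>I a v. f (a + t *\<^sub>R v) = 0)
      \<or> {t\<in>I a v. f (a + t *\<^sub>R v) = 0} sparse_in I a v"
    unfolding I_def
    by (intro analytic_zeros_on_line analytic_on_lines_restrict \<open>analytic_on_lines f B\<close>
        convex_connected)
qed

text \<open>
  The line from \<open>x\<close> to \<open>y\<close> has non-isolated zeros at \<open>x\<close>, so all of its points in \<open>B\<close> are zeros.
\<close>
lemma analytic_zero_near_point_imp_zero_on_convex:
  assumes B: "open B" "convex B" "analytic_on_lines f B"
    and x: "x \<in> B" "\<forall>\<^sub>F y in nhds x. f y = 0" and "y \<in> B"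
  shows "f y = 0"
proof -
  let ?I = "{t. x + t *\<^sub>R (y - x) \<in> B}"
  let ?g = "\<lambda>t. f (x + t *\<^sub>R (y - x))"
  have "isCont (\<lambda>t. x + t *\<^sub>R (y - x)) 0"
    by (intro continuous_intros)
  then have "((\<lambda>t. x + t *\<^sub>R (y - x)) \<longlongrightarrow> x) (at 0)"
    by (simp add: isCont_def)
  with x(2) have "\<forall>\<^sub>F t in at 0. ?g t = 0"
    by (rule eventually_compose_filterlim)
  moreover have "\<forall>\<^sub>F t in at 0. t \<in> ?I"
    using analytic_zeros_on_line_in_convex(1)[OF B, of x "y - x"] \<open>x \<in> B\<close>
    by (intro eventually_at_in_open') auto
  ultimately have "\<forall>\<^sub>F t in at 0. t \<in> {t\<in>?I. ?g t = 0}"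
    by eventually_elim auto
  moreover have False if "\<forall>\<^sub>F t in at 0. t \<notin> {t\<in>?I. ?g t = 0}"
  proof -
    from that calculation have "\<forall>\<^sub>F t in at (0::real). False"
      by eventually_elim blast
    then show False by simp
  qed
  moreover have "0 \<in> ?I"
    using \<open>x \<in> B\<close> by simp
  ultimately have "\<not> {t\<in>?I. ?g t = 0} sparse_in ?I"
    using sparse_in_eventually_iff[OF analytic_zeros_on_line_in_convex(1)[OF B, of x "y - x"]]
    by blast
  then have "\<forall>t\<in>?I. ?g t = 0"
    using analytic_zeros_on_line_in_convex(2)[OF B, of x "y - x"] by blast
  moreover have "1 \<in> ?I"
    using \<open>y \<in> B\<close> by simp
  ultimately have "?g 1 = 0" by blast
  then show ?thesis by simp
qed

lemma sets_borel_zeros: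
  fixes f :: "'a::topological_space \<Rightarrow> real"
  assumes "open S" "continuous_on S f"
  shows "{x\<in>S. f x = 0} \<in> sets borel"
proof -
  obtain T where "closed T" "{x\<in>S. f x = 0} = S \<inter> T"
    using continuous_closedin_preimage_constant[OF assms(2)] by (metis closedin_closed)
  with \<open>open S\<close> show ?thesis by auto
qed

lemma analytic_zeros_null_on_convex:
  fixes f :: "'a::euclidean_space \<Rightarrow> real"
  assumes B: "open B" "convex B" "analytic_on_lines f B"
    and cont: "continuous_on B f" and a: "a \<in> B" "f a \<noteq> 0"
  shows "{x\<in>B. f x = 0} \<in> null_sets lborel"
proof (rule null_set_if_countable_on_lines_through)
  show "{x\<in>B. f x = 0} \<in> sets borel"
    by (rule sets_borel_zeros[OF B(1) cont])
  fix v
  let ?I = "{t. a + t *\<^sub>R v \<in> B}"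
  have "\<not> (\<forall>t\<in>?I. f (a + t *\<^sub>R v) = 0)"
    using a by (auto intro: exI[of _ 0])
  then have "{t\<in>?I. f (a + t *\<^sub>R v) = 0} sparse_in ?I"
    using analytic_zeros_on_line_in_convex(2)[OF B, of a v] by blast
  then have "countable (?I \<inter> {t\<in>?I. f (a + t *\<^sub>R v) = 0})"
    by (rule sparse_imp_countable[OF analytic_zeros_on_line_in_convex(1)[OF B]])
  then show "countable {t. a + t *\<^sub>R v \<in> {x\<in>B. f x = 0}}"
    by (rule countable_subset[rotated]) auto
qed

lemma analytic_on_lines_subset:
  "analytic_on_lines f S \<Longrightarrow> T \<subseteq> S \<Longrightarrow> analytic_on_lines f T"
  by (auto simp: analytic_on_lines_def)

section \<open>The zero set on a connected open set\<close>

theorem analytic_zero_set_all_or_null: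
  fixes f :: "'a::euclidean_space \<Rightarrow> real"
  assumes "open \<Omega>" "connected \<Omega>" and cont: "continuous_on \<Omega> f"
    and an: "analytic_on_lines f \<Omega>"
  shows "{x\<in>\<Omega>. f x = 0} = \<Omega> \<or> {x\<in>\<Omega>. f x = 0} \<in> null_sets lborel"
proof -
  let ?flat = "\<lambda>x. \<forall>\<^sub>F y in nhds x. f y = 0"
  have flat_on_convex: "?flat y"
    if B: "open B" "convex B" "B \<subseteq> \<Omega>" and x: "x \<in> B" "?flat x" and "y \<in> B" for B x y
  proof -
    have "\<forall>z\<in>B. f z = 0"
      using analytic_zero_near_point_imp_zero_on_convex[OF B(1,2) analytic_on_lines_subset[OF an B(3)] x]
      by blast
    then show ?thesis
      using B(1) \<open>y \<in> B\<close> by (auto simp: eventually_nhds)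
  qed
  \<comment> \<open>On a ball inside \<open>\<Omega>\<close> vanishing near one point means vanishing near every point, so
     \<open>?flat\<close> is locally constant.\<close>
  have const: "?flat x = ?flat y" if "x \<in> \<Omega>" "y \<in> \<Omega>" for x y
  proof (rule connected_local_const[OF \<open>connected \<Omega>\<close> that], intro ballI)
    fix a assume "a \<in> \<Omega>"
    then obtain r where r: "r > 0" "ball a r \<subseteq> \<Omega>"
      using \<open>open \<Omega>\<close> open_contains_ball by blast
    have "\<forall>\<^sub>F b in at a within \<Omega>. b \<in> ball a r"
      by (rule filter_leD[OF at_le[of \<Omega> UNIV]]) (use r(1) in \<open>auto intro!: eventually_at_in_open' simp del: mem_ball\<close>)
    then show "\<forall>\<^sub>F b in at a within \<Omega>. ?flat a = ?flat b"
    proof eventually_elim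
      case (elim b)
      have "a \<in> ball a r" using r(1) by simp
      then show ?case
        using flat_on_convex[OF open_ball convex_ball r(2)] elim by blast
    qed
  qed
  show ?thesis
  proof (cases "\<exists>x\<in>\<Omega>. ?flat x")
    case True
    with const have "\<forall>x\<in>\<Omega>. ?flat x" by blast
    then show ?thesis by (auto dest: eventually_nhds_x_imp_x)
  next
    case False
    let ?Z = "{x\<in>\<Omega>. f x = 0}"
    define \<B> where "\<B> = {B. open B \<and> convex B \<and> B \<subseteq> \<Omega>}"
    obtain \<C> where \<C>: "\<C> \<subseteq> \<B>" "countable \<C>" "\<Union>\<C> = \<Union>\<B>"
      using Lindelof[of \<B>] by (auto simp: \<B>_def)
    have null: "{x\<in>B. f x = 0} \<in> null_sets lborel" if "B \<in> \<B>" for B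
    proof (cases "\<exists>a\<in>B. f a \<noteq> 0")
      case True
      with that show ?thesis
        by (auto simp: \<B>_def intro: analytic_zeros_null_on_convex analytic_on_lines_subset[OF an]
            continuous_on_subset[OF cont])
    next
      case nonzero: False
      have "B = {}"
      proof (rule equals0I)
        fix x assume "x \<in> B"
        with nonzero that have "?flat x" by (auto simp: \<B>_def eventually_nhds)
        with False \<open>x \<in> B\<close> that show False by (auto simp: \<B>_def)
      qed
      then show ?thesis by simp
    qed
    have "x \<in> \<Union>\<B>" if "x \<in> \<Omega>" for x
    proof -
      obtain r where "r > 0" "ball x r \<subseteq> \<Omega>"
        using \<open>open \<Omega>\<close> \<open>x \<in> \<Omega>\<close> open_contains_ball by blast
      then show ?thesis
        by (intro UnionI[of "ball x r"]) (auto simp: \<B>_def)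
    qed
    then have "?Z = (\<Union>B\<in>\<C>. {x\<in>B. f x = 0})"
      using \<C> by (auto simp: \<B>_def)
    also have "\<dots> \<in> null_sets lborel"
      using \<C> null by (intro null_sets_UN') auto
    finally show ?thesis ..
  qed
qed

section \<open>Repeated eigenvalues and the discriminant\<close>

text \<open>
  The second elementary symmetric function of the eigenvalues.
\<close>
definition minor_sum :: "real^3^3 \<Rightarrow> real" where
  "minor_sum A = A$1$1 * A$2$2 - A$1$2 * A$2$1 + (A$1$1 * A$3$3 - A$1$3 * A$3$1)
               + (A$2$2 * A$3$3 - A$2$3 * A$3$2)"

text \<open>
  For a traceless matrix this is minus the discriminant of the characteristic polynomial; the sign
  does not affect where it vanishes.
\<close>
definition discr :: "real^3^3 \<Rightarrow> real" where
  "discr A = 4 * minor_sum A ^ 3 + 27 * det A ^ 2"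

lemma charpoly_S0:
  assumes "A \<in> S0"
  shows "charpoly A = [:- det A, minor_sum A, 0, 1:]"
proof -
  have "A$1$1 + A$2$2 + A$3$3 = 0"
    using assms by (simp add: S0_def trace_def sum_3)
  then have "A$3$3 = - A$1$1 - A$2$2"
    by simp
  then have "poly (charpoly A) x = poly [:- det A, minor_sum A, 0, 1:] x" for x
    by (simp add: poly_charpoly det_3 mat_def minor_sum_def) (simp add: algebra_simps)
  then show ?thesis
    by (simp add: poly_eq_poly_eq_iff[symmetric] fun_eq_iff)
qed

text \<open>
  As the quadratic coefficient is zero, the roots add up to zero, so a double root \<open>l\<close> forces the
  factorization \<open>(X - l) ^ 2 (X + 2 l)\<close>.
\<close>
lemma order_depressed_cubic_ge_2_iff:
  fixes l :: real
  shows "order l [:q, p, 0, 1:] \<ge> 2 \<longleftrightarrow> p = - 3 * l^2 \<and> q = 2 * l^3"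
proof -
  let ?P = "[:q, p, 0, 1:]"
  have "order l ?P \<ge> 2 \<longleftrightarrow> [:- l, 1:]^2 dvd ?P"
    by (simp add: order_divides)
  also have "\<dots> \<longleftrightarrow> p = - 3 * l^2 \<and> q = 2 * l^3"
  proof
    assume "[:- l, 1:]^2 dvd ?P"
    then obtain R where R: "?P = [:- l, 1:]^2 * R" ..
    have "poly ?P l = 0" "poly (pderiv ?P) l = 0"
      unfolding R power2_eq_square mult.assoc by (simp_all only: pderiv_mult poly_add poly_mult) simp_all
    then have "q + l * p + l^3 = 0" "p + 3 * l^2 = 0"
      by (simp_all add: pderiv_pCons power2_eq_square power3_eq_cube algebra_simps)
    then show "p = - 3 * l^2 \<and> q = 2 * l^3"
      by algebra
  next
    assume "p = - 3 * l^2 \<and> q = 2 * l^3"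
    then have "?P = [:- l, 1:]^2 * [:2 * l, 1:]"
      by (simp add: power2_eq_square power3_eq_cube algebra_simps)
    then show "[:- l, 1:]^2 dvd ?P" by (metis dvd_triv_left)
  qed
  finally show ?thesis .
qed

text \<open>
  The trace of \<open>A ^ 2\<close> is \<open>- 2 * minor_sum A\<close> for traceless \<open>A\<close>, and for symmetric \<open>A\<close> it is the sum
  of the squares of all entries.
\<close>
lemma minor_sum_S0_eq_0_iff:
  assumes "A \<in> S0"
  shows "minor_sum A = 0 \<longleftrightarrow> A = 0"
proof
  assume "minor_sum A = 0"
  have sym: "A$i$j = A$j$i" for i j
    using assms by (simp add: S0_def transpose_def vec_eq_iff)
  have tr: "A$3$3 = - A$1$1 - A$2$2"
    using assms by (simp add: S0_def trace_def sum_3)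
  have "(A$1$1)^2 + (A$2$2)^2 + (A$1$1 + A$2$2)^2 + 2 * (A$1$2)^2 + 2 * (A$1$3)^2 + 2 * (A$2$3)^2
      = - 2 * minor_sum A"
    unfolding minor_sum_def tr sym[of 2 1] sym[of 3 1] sym[of 3 2] by algebra
  with \<open>minor_sum A = 0\<close> have "A$1$1 = 0" "A$2$2 = 0" "A$1$2 = 0" "A$1$3 = 0" "A$2$3 = 0"
    by (smt (verit) zero_le_power2 power2_eq_iff_nonneg zero_eq_power2)+
  with tr sym[of 2 1] sym[of 3 1] sym[of 3 2] show "A = 0"
    by (simp add: vec_eq_iff forall_3)
qed (simp add: minor_sum_def)

text \<open>
  If the discriminant vanishes but \<open>p \<noteq> 0\<close>, the double root of \<open>X ^ 3 + p X + q\<close> is \<open>- 3 q / (2 p)\<close>,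
  here with \<open>q = - det A\<close>. If \<open>p = 0\<close>, then \<open>A = 0\<close>.
\<close>
lemma uniaxial_or_isotropic_iff_discr_eq_0:
  assumes "A \<in> S0"
  shows "uniaxial A \<or> isotropic A \<longleftrightarrow> discr A = 0"
proof
  assume "uniaxial A \<or> isotropic A"
  then show "discr A = 0"
  proof
    assume "uniaxial A"
    then obtain l where "minor_sum A = - 3 * l^2" "- det A = 2 * l^3"
      by (auto simp: uniaxial_def charpoly_S0[OF assms] order_depressed_cubic_ge_2_iff)
    then show ?thesis
      unfolding discr_def by algebra
  next
    assume "isotropic A"
    then show ?thesis
      by (simp add: isotropic_def discr_def minor_sum_def det_3)
  qed
next
  assume D: "discr A = 0"
  show "uniaxial A \<or> isotropic A"
  proof (cases "minor_sum A = 0")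
    case True
    then show ?thesis
      by (simp add: isotropic_def minor_sum_S0_eq_0_iff[OF assms])
  next
    case False
    define l where "l = 3 * det A / (2 * minor_sum A)"
    have l: "2 * minor_sum A * l = 3 * det A"
      using False by (simp add: l_def)
    have D': "4 * minor_sum A ^ 3 + 27 * det A ^ 2 = 0"
      using D by (simp add: discr_def)
    have "minor_sum A ^ 2 * (minor_sum A + 3 * l^2) = 0" "minor_sum A ^ 3 * (det A + 2 * l^3) = 0"
      using l D' by algebra+
    with False have eqs: "minor_sum A = - 3 * l^2" "- det A = 2 * l^3"
      by auto
    with False have "l \<noteq> 0" by auto
    with eqs have "uniaxial A"
      unfolding uniaxial_def charpoly_S0[OF assms] order_depressed_cubic_ge_2_iff by blast
    then show ?thesis ..
  qed
qed

section \<open>Uniaxial and isotropic points\<close>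

theorem proposition15:
  fixes \<Omega> :: "(real^3) set" and Q :: "real^3 \<Rightarrow> real^3^3"
  assumes "open \<Omega>" and "bounded \<Omega>" and "simply_connected \<Omega>" and "smooth_boundary \<Omega>"
    and "Q \<in> \<Omega> \<rightarrow> S0" and "real_analytic_on Q \<Omega>"
  shows "{x \<in> \<Omega>. uniaxial (Q x) \<or> isotropic (Q x)} = \<Omega> \<or>
         {x \<in> \<Omega>. uniaxial (Q x) \<or> isotropic (Q x)} \<in> null_sets lebesgue"
proof -
  have entry: "real_analytic_on (\<lambda>x. Q x $ i $ j) \<Omega>" for i j
    by (rule real_analytic_on_bounded_linear[OF real_analytic_on_bounded_linear])
       (use assms in \<open>auto intro: bounded_linear_vec_nth\<close>)
  have an: "analytic_on_lines (\<lambda>x. Q x $ i $ j) \<Omega>"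
    and cont: "continuous_on \<Omega> (\<lambda>x. Q x $ i $ j)" for i j
    using real_analytic_on_imp_analytic_on_lines[OF entry] real_analytic_on_imp_isCont[OF entry]
    by (auto intro: continuous_at_imp_continuous_on)
  have "analytic_on_lines (\<lambda>x. discr (Q x)) \<Omega>"
    unfolding discr_def minor_sum_def det_3 by (intro analytic_on_lines_intros an)
  moreover have "continuous_on \<Omega> (\<lambda>x. discr (Q x))"
    unfolding discr_def minor_sum_def det_3 
    by (intro continuous_on_add continuous_on_diff continuous_on_mult continuous_on_power
        continuous_on_const cont)
  ultimately have "{x\<in>\<Omega>. discr (Q x) = 0} = \<Omega> \<or> {x\<in>\<Omega>. discr (Q x) = 0} \<in> null_sets lborel"
    by (rule analytic_zero_set_all_or_null
        [OF assms(1) simply_connected_imp_connected[OF assms(3)], rotated])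
  moreover have "{x \<in> \<Omega>. uniaxial (Q x) \<or> isotropic (Q x)} = {x\<in>\<Omega>. discr (Q x) = 0}"
    using assms(5) uniaxial_or_isotropic_iff_discr_eq_0 by blast
  ultimately show ?thesis
    by (auto intro: null_sets_completionI)
qed

end
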